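(* Let $\sigma:\mathbf{R}\to\mathbf{R}$ be globally Lipschitz with optimal Lipschitz constant $\mathrm{Lip}_\sigma$, and suppose that there exist unique solutions $\mathbf{u}=\{u_n(x)\}_{n\ge 0,x\in\mathbf{Z}^d}$ and $\mathbf{v}=\{v_n(x)\}_{n\ge 0,x\in\mathbf{Z}^d}$ of the equation $$u_{n+1}(x)-u_n(x)=(\mathcal{L}u_n)(x)+\sigma(u_n(x))\,\xi_n(x)\qquad (n\ge 0,\ x\in\mathbf{Z}^d)$$ with respective initial data $u_0$ and $v_0$. Suppose that $C_\xi:=\sup_{n\ge 0}\sup_{x\in\mathbf{Z}^d}|\xi_n(x)|$ is finite and satisfies $$P_{0,0}\ge C_\xi\,\mathrm{Lip}_\sigma.$$ Then $u_0\ge v_0$ implies that $u_n\ge v_n$ for all $n\ge 0$.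
   Context: $\mathcal{L}$ is the generator of a random walk on $\mathbf{Z}^d$: $\mathcal{L}=\mathcal{P}-\mathcal{I}$, where $\mathcal{I}$ is the identity and $(\mathcal{P}h)(x)=\sum_{y\in\mathbf{Z}^d}P_{x,y}h(y)$ with $P_{x,y}=P_{0,y-x}$ the one-step transition probabilities of the walk. $\{\xi_n(x)\}_{n\ge 0,x\in\mathbf{Z}^d}$ is the (real-valued) forcing, the same for both solutions. Inequalities between functions on $\mathbf{Z}^d$ are pointwise. $\mathrm{Lip}_\sigma:=\sup_{x\ne y}|\sigma(x)-\sigma(y)|/|x-y|$. *)

theory Defs
  imports "HOL-Analysis.Analysis"
begin

definition walk_kernel :: "(int ^ 'd \<Rightarrow> int ^ 'd \<Rightarrow> real) \<Rightarrow> bool" where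
  "walk_kernel P \<longleftrightarrow>
     (\<forall>x y. 0 \<le> P x y) \<and> (\<forall>x. (P x has_sum 1) UNIV) \<and> (\<forall>x y. P x y = P 0 (y - x))"

definition transition_op ::
  "(int ^ 'd \<Rightarrow> int ^ 'd \<Rightarrow> real) \<Rightarrow> (int ^ 'd \<Rightarrow> real) \<Rightarrow> int ^ 'd \<Rightarrow> real" where
  "transition_op P h x = (\<Sum>\<^sub>\<infinity>y\<in>UNIV. P x y * h y)"

definition generator ::
  "(int ^ 'd \<Rightarrow> int ^ 'd \<Rightarrow> real) \<Rightarrow> (int ^ 'd \<Rightarrow> real) \<Rightarrow> int ^ 'd \<Rightarrow> real" where
  "generator P h x = transition_op P h x - h x"

text \<open>
  The walk may have infinite range, so a solution must be such that the series defining the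
  generator converges; otherwise \<open>infsum\<close> silently returns 0. For real series,
  \<open>summable_on\<close> is absolute convergence.
\<close>
definition is_solution ::
  "(int ^ 'd \<Rightarrow> int ^ 'd \<Rightarrow> real) \<Rightarrow> (real \<Rightarrow> real) \<Rightarrow> (nat \<Rightarrow> int ^ 'd \<Rightarrow> real)
    \<Rightarrow> (int ^ 'd \<Rightarrow> real) \<Rightarrow> (nat \<Rightarrow> int ^ 'd \<Rightarrow> real) \<Rightarrow> bool" where
  "is_solution P \<sigma> \<xi> u0 u \<longleftrightarrow>
     u 0 = u0 \<and>
     (\<forall>n x. (\<lambda>y. P x y * u n y) summable_on UNIV) \<and>
     (\<forall>n x. u (Suc n) x - u n x = generator P (u n) x + \<sigma> (u n x) * \<xi> n x)"

definition is_unique_solution ::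
  "(int ^ 'd \<Rightarrow> int ^ 'd \<Rightarrow> real) \<Rightarrow> (real \<Rightarrow> real) \<Rightarrow> (nat \<Rightarrow> int ^ 'd \<Rightarrow> real)
    \<Rightarrow> (int ^ 'd \<Rightarrow> real) \<Rightarrow> (nat \<Rightarrow> int ^ 'd \<Rightarrow> real) \<Rightarrow> bool" where
  "is_unique_solution P \<sigma> \<xi> u0 u \<longleftrightarrow>
     is_solution P \<sigma> \<xi> u0 u \<and> (\<forall>w. is_solution P \<sigma> \<xi> u0 w \<longrightarrow> w = u)"

text \<open>The suprema are taken in the extended reals, where they always exist.\<close>
definition Lip :: "(real \<Rightarrow> real) \<Rightarrow> ereal" where
  "Lip \<sigma> = (SUP (x, y) \<in> {(x, y). x \<noteq> y}. ereal (\<bar>\<sigma> x - \<sigma> y\<bar> / \<bar>x - y\<bar>))"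

definition forcing_sup :: "(nat \<Rightarrow> int ^ 'd \<Rightarrow> real) \<Rightarrow> ereal" where
  "forcing_sup \<xi> = (SUP n. SUP x. ereal \<bar>\<xi> n x\<bar>)"

end

theory Submission
  imports Defs
begin

text \<open>
  A solution satisfies \<open>u (Suc n) x = transition_op P (u n) x + \<sigma> (u n x) * \<xi> n x\<close>: the
  \<open>- u n x\<close> in the generator cancels the one on the left. So the update is monotone in
  \<open>u n\<close> as soon as the noise term cannot undo the gain from the averaging. If \<open>u n \<ge> v n\<close>,
  then averaging over a step of the walk gains at least the contribution \<open>P 0 0 * (u n x - v n x)\<close>
  of the event that the walk stays put (\<open>transition_op_diff_ge_diagonal\<close>), while the noise
  changes the difference by at most \<open>C\<^sub>\<xi> Lip\<^sub>\<sigma> (u n x - v n x)\<close> in absolute value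
  (\<open>forcing_increment_le\<close>). The hypothesis \<open>P 0 0 \<ge> C\<^sub>\<xi> Lip\<^sub>\<sigma>\<close> says that the gain wins, and the
  comparison propagates by induction on time.
\<close>

text \<open>
  Both suprema are at least each of their terms, and all terms are nonnegative, so the product of
  the suprema bounds every product of a difference quotient with a value of the forcing. When
  \<open>a = b\<close> there is no difference quotient, but both sides vanish.
\<close>
lemma forcing_increment_le:
  assumes "forcing_sup \<xi> * Lip \<sigma> \<le> ereal p"
  shows "\<bar>(\<sigma> a - \<sigma> b) * \<xi> n x\<bar> \<le> p * \<bar>a - b\<bar>"
proof (cases "a = b")
  case False
  define q where "q = \<bar>\<sigma> a - \<sigma> b\<bar> / \<bar>a - b\<bar>"
  have "ereal q \<le> Lip \<sigma>"
    unfolding Lip_def q_def using False by (intro SUP_upper2[of "(a, b)"]) auto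
  moreover have "ereal \<bar>\<xi> n x\<bar> \<le> forcing_sup \<xi>"
    unfolding forcing_sup_def by (meson SUP_upper2 UNIV_I order_refl)
  ultimately have "ereal \<bar>\<xi> n x\<bar> * ereal q \<le> forcing_sup \<xi> * Lip \<sigma>"
    by (intro ereal_mult_mono) (auto simp: q_def intro: order_trans[rotated])
  with assms have "ereal (\<bar>\<xi> n x\<bar> * q) \<le> ereal p"
    using order_trans by fastforce
  then have "\<bar>\<xi> n x\<bar> * q * \<bar>a - b\<bar> \<le> p * \<bar>a - b\<bar>"
    by (intro mult_right_mono) auto
  with False show ?thesis
    by (simp add: q_def abs_mult mult.commute)
qed simp

text \<open>
  The terms of the series for the difference are nonnegative, so the series is at least its term
  at \<open>y = x\<close>, whose weight is \<open>P x x = P 0 0\<close> by translation invariance.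
\<close>
lemma transition_op_diff_ge_diagonal:
  fixes P :: "int ^ 'd \<Rightarrow> int ^ 'd \<Rightarrow> real"
  assumes P: "walk_kernel P"
    and f: "(\<lambda>y. P x y * f y) summable_on UNIV"
    and g: "(\<lambda>y. P x y * g y) summable_on UNIV"
    and le: "g \<le> f"
  shows "P 0 0 * (f x - g x) \<le> transition_op P f x - transition_op P g x"
proof -
  have nonneg: "0 \<le> P x y * f y - P x y * g y" for y
    using P le by (auto simp: walk_kernel_def le_fun_def mult_left_mono)
  have "((\<lambda>y. P x y * f y + - (P x y * g y)) has_sum
      (transition_op P f x + - transition_op P g x)) UNIV"
    unfolding transition_op_def
    by (intro has_sum_add has_sum_uminus[THEN iffD2] has_sum_infsum) (use f g in auto)
  then have diff: "((\<lambda>y. P x y * f y - P x y * g y) has_sum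
      (transition_op P f x - transition_op P g x)) UNIV"
    by simp
  have "P x x = P 0 0"
    using P unfolding walk_kernel_def by (metis diff_self)
  then have "P 0 0 * (f x - g x) = (\<Sum>y\<in>{x}. P x y * f y - P x y * g y)"
    by (simp add: right_diff_distrib)
  also have "\<dots> \<le> transition_op P f x - transition_op P g x"
    using diff nonneg by (intro finite_sum_le_has_sum[OF diff]) auto
  finally show ?thesis .
qed

theorem theorem3p5:
  fixes P :: "int ^ 'd \<Rightarrow> int ^ 'd \<Rightarrow> real"
    and \<sigma> :: "real \<Rightarrow> real"
    and \<xi> :: "nat \<Rightarrow> int ^ 'd \<Rightarrow> real"
    and u v :: "nat \<Rightarrow> int ^ 'd \<Rightarrow> real"
    and u0 v0 :: "int ^ 'd \<Rightarrow> real"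
  assumes "walk_kernel P"
    and "\<exists>L. L-lipschitz_on UNIV \<sigma>"
    and "is_unique_solution P \<sigma> \<xi> u0 u"
    and "is_unique_solution P \<sigma> \<xi> v0 v"
    and "forcing_sup \<xi> < \<infinity>"
    and "ereal (P 0 0) \<ge> forcing_sup \<xi> * Lip \<sigma>"
    and "u0 \<ge> v0"
  shows "\<forall>n. u n \<ge> v n"
proof
  fix n
  have u: "is_solution P \<sigma> \<xi> u0 u" and v: "is_solution P \<sigma> \<xi> v0 v"
    using assms(3,4) by (auto simp: is_unique_solution_def)
  show "u n \<ge> v n"
  proof (induction n)
    case 0
    show ?case
      using u v assms(7) by (simp add: is_solution_def)
  next
    case (Suc n)
    show ?case
    proof (rule le_funI)
      fix x
      have "u (Suc n) x = transition_op P (u n) x + \<sigma> (u n x) * \<xi> n x"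
        and "v (Suc n) x = transition_op P (v n) x + \<sigma> (v n x) * \<xi> n x"
        using u v by (auto simp: is_solution_def generator_def)
      then have step: "u (Suc n) x - v (Suc n) x =
          (transition_op P (u n) x - transition_op P (v n) x)
            + (\<sigma> (u n x) - \<sigma> (v n x)) * \<xi> n x"
        by (simp add: algebra_simps)
      have gain: "P 0 0 * (u n x - v n x) \<le> transition_op P (u n) x - transition_op P (v n) x"
        using u v Suc.IH
        by (intro transition_op_diff_ge_diagonal assms(1)) (auto simp: is_solution_def)
      have "\<bar>(\<sigma> (u n x) - \<sigma> (v n x)) * \<xi> n x\<bar> \<le> P 0 0 * \<bar>u n x - v n x\<bar>"
        by (intro forcing_increment_le assms(6))
      moreover have "\<bar>u n x - v n x\<bar> = u n x - v n x"
        using le_funD[OF Suc.IH, of x] by simp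
      ultimately show "v (Suc n) x \<le> u (Suc n) x"
        using step gain by simp
    qed
  qed
qed

end
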